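(* Let $G\in\varepsilon_{12}$ and let $C,C'$ be two cycles of $G$ whose intersection is a path $P_t$ with $t>0$ edges. If both $C,C'$ are of type $2$, or one is of type $1$ and the other of type $2$, then $t$ is odd. If both are of type $1$, then $t$ is even.
   Context: All graphs are finite, simple and connected. An Euler graph is a connected graph all of whose nodes have even degree. A cycle of length $n$ is of type $i$ if $n\equiv i\pmod 4$. $\varepsilon_{12}$ is the class of Euler graphs in which every cycle has length $\equiv 1$ or $\equiv 2\pmod 4$ and which contain at least one cycle of each of the types $1$ and $2$. *)

theory Defs
  imports "Graph_Theory.Digraph_Component"
begin

text \<open>
  A finite simple graph is a symmetric digraph without loops and multiple arcs (locale
  \<^locale>\<open>graph\<close>): every undirected edge is a pair of opposite arcs, so the degree of a vertex is
  its \<^const>\<open>out_degree\<close>.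
\<close>

definition euler_graph :: "('a, 'b) pre_digraph \<Rightarrow> bool" where
  "euler_graph G \<longleftrightarrow> graph G \<and> connected G \<and> (\<forall>v \<in> verts G. even (out_degree G v))"

text \<open>
  The directed notion \<^const>\<open>pre_digraph.cycle\<close> also admits the closed walk that traverses an edge
  back and forth, which is not a cycle of an undirected simple graph; the bound on the length
  excludes exactly these walks.
\<close>

definition graph_cycle :: "('a, 'b) pre_digraph \<Rightarrow> 'b awalk \<Rightarrow> bool" where
  "graph_cycle G C \<longleftrightarrow> pre_digraph.cycle G C \<and> 3 \<le> length C"

definition of_type :: "'b awalk \<Rightarrow> nat \<Rightarrow> bool" where
  "of_type C i \<longleftrightarrow> length C mod 4 = i mod 4"

definition eps12 :: "('a, 'b) pre_digraph set" where
  "eps12 = {G. euler_graph G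
     \<and> (\<forall>C. graph_cycle G C \<longrightarrow> of_type C 1 \<or> of_type C 2)
     \<and> (\<exists>C. graph_cycle G C \<and> of_type C 1)
     \<and> (\<exists>C. graph_cycle G C \<and> of_type C 2)}"

text \<open>
  Undirected edges, so that the direction in which a walk traverses an edge is irrelevant.
\<close>

definition walk_edges :: "('a, 'b) pre_digraph \<Rightarrow> 'b awalk \<Rightarrow> 'a set set" where
  "walk_edges G p = (\<lambda>e. {tail G e, head G e}) ` set p"

definition cycle_verts :: "('a, 'b) pre_digraph \<Rightarrow> 'b awalk \<Rightarrow> 'a set" where
  "cycle_verts G C = \<Union> (walk_edges G C)"

text \<open>
  The intersection of two cycles is the one of subgraphs: common vertices and common edges.
\<close>

definition inter_is_path :: "('a, 'b) pre_digraph \<Rightarrow> 'b awalk \<Rightarrow> 'b awalk \<Rightarrow> nat \<Rightarrow> bool" where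
  "inter_is_path G C C' t \<longleftrightarrow> (\<exists>u P v. pre_digraph.apath G u P v \<and> length P = t
     \<and> cycle_verts G C \<inter> cycle_verts G C' = set (pre_digraph.awalk_verts G u P)
     \<and> walk_edges G C \<inter> walk_edges G C' = walk_edges G P)"

end

theory Submission
  imports Defs
begin

text \<open>
  Both cycles decompose as \<open>P\<close> followed by a path from the end of \<open>P\<close> back to its start, say
  \<open>Q\<close> and \<open>Q'\<close>. As the cycles share only \<open>P\<close>, following \<open>Q\<close> and then \<open>Q'\<close> backwards gives a third
  cycle, whose length \<open>|C| + |C'| - 2t\<close> must again be \<open>1\<close> or \<open>2\<close> modulo \<open>4\<close>.
\<close>

section \<open>Tails and heads along closed walks\<close>

lemma (in pre_digraph) cas_tails_heads:
  "cas u p v \<Longrightarrow> map (tail G) p @ [v] = u # map (head G) p"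
  by (induction p arbitrary: u) auto

lemma (in pre_digraph) cas_set_heads:
  "cas u p v \<Longrightarrow> insert v (tail G ` set p) = insert u (head G ` set p)"
  using arg_cong[OF cas_tails_heads, of u p v set] by simp

lemma (in pre_digraph) awalk_verts_eq_tails:
  "cas u p v \<Longrightarrow> awalk_verts u p = map (tail G) p @ [v]"
  by (induction p arbitrary: u) auto

lemma (in pre_digraph) cas_closed_mset:
  assumes "cas u p u"
  shows "mset (map (tail G) p) = mset (map (head G) p)"
  using arg_cong[OF cas_tails_heads[OF assms], of mset] by simp

lemma (in pre_digraph) cas_closed_distinct_iff:
  "cas u p u \<Longrightarrow> distinct (map (tail G) p) \<longleftrightarrow> distinct (map (head G) p)"
  by (rule mset_eq_imp_distinct_iff[OF cas_closed_mset])

text \<open>\<open>cycle\<close> speaks of the vertices after the first, which are the heads; on a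
  closed walk these are the tails up to order. The form with \<open>map\<close> splits over
  concatenation, which makes rotating and gluing walks easy.\<close>

lemma (in pre_digraph) cycle_iff_distinct_tails:
  "cycle p \<longleftrightarrow> p \<noteq> [] \<and> (\<exists>u. awalk u p u \<and> distinct (map (tail G) p))"
proof -
  have "tl (awalk_verts u p) = map (head G) p" if "awalk u p u" for u
    using that by (auto simp: awalk_def awalk_verts_eq_tails[of u p u] cas_tails_heads[of u p u])
  moreover have "distinct (map (tail G) p) \<longleftrightarrow> distinct (map (head G) p)" if "awalk u p u" for u
    using that cas_closed_distinct_iff unfolding awalk_def by blast
  ultimately show ?thesis
    unfolding cycle_def by metis
qed

lemma (in wf_digraph) awalk_append_iff_ex:
  "awalk u (p @ q) v \<longleftrightarrow> (\<exists>w. awalk u p w \<and> awalk w q v)"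
  unfolding awalk_append_iff by (auto dest: awlast_of_awalk)

lemma walk_edges_append: "walk_edges G (p @ q) = walk_edges G p \<union> walk_edges G q"
  by (auto simp: walk_edges_def)

text \<open>A closed walk leaves each vertex as often as it enters it, so the tails alone, or the
  heads alone, already give all its vertices.\<close>

lemma (in pre_digraph) cycle_verts_closed:
  assumes "cas u p u"
  shows "cycle_verts G p = tail G ` set p" and "cycle_verts G p = head G ` set p"
proof -
  have "tail G ` set p = head G ` set p"
    using mset_eq_setD[OF cas_closed_mset[OF assms]] by simp
  then show "cycle_verts G p = tail G ` set p" "cycle_verts G p = head G ` set p"
    by (auto simp: cycle_verts_def walk_edges_def)
qed

text \<open>Each arc is replaced by an opposite one, which symmetry supplies. The exact lists of
  tails and heads are recorded so that distinctness and positions carry over to the reversed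
  walk.\<close>

lemma (in sym_digraph) awalk_reverse:
  assumes "awalk u p v"
  obtains q where "awalk v q u" "map (tail G) q = rev (map (head G) p)"
    "map (head G) q = rev (map (tail G) p)" "walk_edges G q = walk_edges G p"
proof -
  have "\<exists>q. awalk v q u \<and> map (tail G) q = rev (map (head G) p) \<and>
    map (head G) q = rev (map (tail G) p) \<and> walk_edges G q = walk_edges G p"
    using assms
  proof (induction p arbitrary: u)
    case Nil
    then show ?case by (auto simp: awalk_Nil_iff)
  next
    case (Cons e p)
    then have e: "e \<in> arcs G" "tail G e = u" and p: "awalk (head G e) p v"
      by (auto simp: awalk_Cons_iff)
    obtain q where q: "awalk v q (head G e)" "map (tail G) q = rev (map (head G) p)"
      "map (head G) q = rev (map (tail G) p)" "walk_edges G q = walk_edges G p"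
      using Cons.IH[OF p] by blast
    obtain e' where e': "e' \<in> arcs G" "tail G e' = head G e" "head G e' = u"
      using sym_arcs e unfolding symmetric_conv by metis
    have "awalk (head G e) [e'] u"
      using e' by (auto simp: awalk_Cons_iff awalk_Nil_iff)
    then have "awalk v (q @ [e']) u"
      using q(1) awalk_append_iff_ex by blast
    then show ?case
      using q e e' by (intro exI[of _ "q @ [e']"]) (auto simp: walk_edges_def)
  qed
  then show thesis using that by blast
qed

section \<open>Cycles that follow a given path, and gluing their remainders\<close>

context graph
begin

text \<open>Moving the arcs before \<open>e\<close> to the end keeps the walk closed and only
  permutes its tails.\<close>

lemma cycle_rotate_to_arc:
  assumes "cycle C" and "e \<in> set C"
  obtains Q where "cycle (e # Q)" "walk_edges G (e # Q) = walk_edges G C"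
    "length (e # Q) = length C"
proof -
  obtain A B where C: "C = A @ e # B" using assms(2) by (meson split_list)
  obtain u where u: "awalk u C u" "distinct (map (tail G) C)"
    using assms(1) cycle_iff_distinct_tails by blast
  then obtain w where "awalk u A w" "awalk w (e # B) u"
    unfolding C awalk_append_iff_ex by blast
  then have "awalk w ((e # B) @ A) w" using awalk_append_iff_ex by blast
  moreover have "distinct (map (tail G) ((e # B) @ A))" using u(2) unfolding C by auto
  ultimately have "cycle (e # B @ A)" unfolding cycle_iff_distinct_tails by auto
  then show thesis by (rule that) (auto simp: C walk_edges_def)
qed

text \<open>\<open>walk_edges\<close> forgets directions, so \<open>C\<close> may traverse the edge
  against \<open>e\<close>; in that case \<open>C\<close> is reversed first. Without parallel arcs,
  an arc with the ends of \<open>e\<close> is \<open>e\<close> itself.\<close>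

lemma cycle_through_edge:
  assumes "cycle C" and "e \<in> arcs G" and "{tail G e, head G e} \<in> walk_edges G C"
  obtains Q where "cycle (e # Q)" "walk_edges G (e # Q) = walk_edges G C"
    "length (e # Q) = length C"
proof -
  obtain u where u: "awalk u C u" "distinct (map (tail G) C)" "C \<noteq> []"
    using assms(1) cycle_iff_distinct_tails by blast
  obtain f where f: "f \<in> set C" "{tail G e, head G e} = {tail G f, head G f}"
    using assms(3) by (auto simp: walk_edges_def)
  show thesis
  proof (cases "tail G f = tail G e")
    case True
    then have "head G f = head G e" using f(2) by (auto simp: doubleton_eq_iff)
    then have "f = e" using True f(1) u(1) assms(2) no_multi_arcs
      by (auto simp: awalk_def arc_to_ends_def)
    then show thesis using cycle_rotate_to_arc[OF assms(1)] f(1) that by blast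
  next
    case False
    then have f_ends: "tail G f = head G e" "head G f = tail G e"
      using f(2) by (auto simp: doubleton_eq_iff)
    obtain D where D: "awalk u D u" "map (tail G) D = rev (map (head G) C)"
      "map (head G) D = rev (map (tail G) C)" "walk_edges G D = walk_edges G C"
      using awalk_reverse[OF u(1)] .
    have len: "length D = length C" using arg_cong[OF D(2), of length] by simp
    have "cas u C u" using u(1) by (simp add: awalk_def)
    then have "distinct (map (tail G) D)"
      unfolding D(2) using u(2) cas_closed_distinct_iff by simp
    then have D_cycle: "cycle D"
      unfolding cycle_iff_distinct_tails using D(1) u(3) len by auto
    obtain i where i: "i < length C" "f = C ! i" using f(1) by (metis in_set_conv_nth)
    \<comment> \<open>Reversal sends position \<open>i\<close> to its mirror image, so
      \<open>g\<close> is the opposite of \<open>f\<close>.\<close>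
    define g where "g = D ! (length C - Suc i)"
    have j: "length C - Suc i < length D" using i len by simp
    have "tail G g = map (tail G) D ! (length C - Suc i)" using j by (simp add: g_def)
    also have "\<dots> = head G f" unfolding D(2) using i by (simp add: rev_nth)
    finally have g_tail: "tail G g = tail G e" using f_ends by simp
    have "head G g = map (head G) D ! (length C - Suc i)" using j by (simp add: g_def)
    also have "\<dots> = tail G f" unfolding D(3) using i by (simp add: rev_nth)
    finally have g_head: "head G g = head G e" using f_ends by simp
    have "g \<in> set D" using j by (simp add: g_def)
    then have "g = e" using D(1) g_tail g_head assms(2) no_multi_arcs
      by (auto simp: awalk_def arc_to_ends_def)
    then have "e \<in> set D" using \<open>g \<in> set D\<close> by simp
    from cycle_rotate_to_arc[OF D_cycle this] show thesis
      using that D(4) len by metis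
  qed
qed

text \<open>Induction along the path: once the cycle starts with \<open>P\<close>, its next arc is
  forced to be the next arc of the path. The remainder \<open>Q\<close> leads back from
  \<open>v\<close> to \<open>u\<close>.\<close>

lemma cycle_extend_path:
  assumes "apath u P v" and "P \<noteq> []" and "cycle C" and "walk_edges G P \<subseteq> walk_edges G C"
  shows "\<exists>Q. cycle (P @ Q) \<and> awalk v Q u \<and> walk_edges G (P @ Q) = walk_edges G C \<and>
    length (P @ Q) = length C"
  using assms
proof (induction P arbitrary: v rule: rev_induct)
  case Nil
  then show ?case by simp
next
  case (snoc e P)
  from snoc.prems(1) have aw: "awalk u (P @ [e]) v" and dist: "distinct (awalk_verts u (P @ [e]))"
    by (auto simp: apath_def)
  from aw have e: "e \<in> arcs G" "awalk u P (tail G e)" "head G e = v"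
    by (auto simp: awalk_append_iff_ex awalk_Cons_iff awalk_Nil_iff)
  have cas: "cas u (P @ [e]) v" using aw by (simp add: awalk_def)
  have dist': "distinct (map (tail G) P @ [tail G e, v])"
    using dist unfolding awalk_verts_eq_tails[OF cas] by simp
  have "{tail G e, head G e} \<in> walk_edges G C"
    using snoc.prems(4) by (auto simp: walk_edges_def)
  show ?case
  proof (cases "P = []")
    \<comment> \<open>The induction really starts here: the first arc of the path fixes the
      direction of the cycle.\<close>
    case True
    obtain Q where Q: "cycle (e # Q)" "walk_edges G (e # Q) = walk_edges G C"
      "length (e # Q) = length C"
      using cycle_through_edge[OF snoc.prems(3) e(1) \<open>{tail G e, head G e} \<in> walk_edges G C\<close>] .
    then have "awalk (head G e) Q (tail G e)"
      by (auto simp: cycle_def awalk_Cons_iff)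
    moreover have "u = tail G e" using e(2) True by (simp add: awalk_Nil_iff)
    ultimately show ?thesis using Q True e by auto
  next
    case False
    have "apath u P (tail G e)"
      using e(2) dist' by (auto simp: apath_def awalk_def awalk_verts_eq_tails[of u P "tail G e"])
    then obtain Q where Q: "cycle (P @ Q)" "awalk (tail G e) Q u"
      "walk_edges G (P @ Q) = walk_edges G C" "length (P @ Q) = length C"
      using snoc.IH[OF _ False snoc.prems(3)] snoc.prems(4) unfolding walk_edges_append by blast
    have casP: "cas u P (tail G e)" using e(2) by (simp add: awalk_def)
    have "u \<in> tail G ` set P" using False casP by (cases P) auto
    then have "Q \<noteq> []" using Q(2) dist' by (auto simp: awalk_Nil_iff)
    then obtain f Q' where f: "Q = f # Q'" by (cases Q) auto
    then have f': "f \<in> arcs G" "tail G f = tail G e" "awalk (head G f) Q' u"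
      using Q(2) by (auto simp: awalk_Cons_iff)
    obtain w where w: "awalk w (P @ Q) w" "distinct (map (tail G) (P @ Q))"
      using Q(1) cycle_iff_distinct_tails by blast
    then have dh: "distinct (map (head G) (P @ Q))"
      using cas_closed_distinct_iff unfolding awalk_def by blast
    have inj: "inj_on (tail G) (set (P @ Q))" "inj_on (head G) (set (P @ Q))"
      using w(2) dh unfolding distinct_map by blast+
    \<comment> \<open>\<open>g\<close> is the arc by which the cycle traverses the edge of
      \<open>e\<close>. If it leaves \<open>tail G e\<close>, it is \<open>f\<close>, since tails
      are distinct. If it enters \<open>tail G e\<close>, it is the arc of \<open>P\<close> that
      does so, since heads are distinct; but then \<open>v\<close> is a tail in \<open>P\<close>,
      and the extended path would repeat a vertex.\<close>
    obtain g where g: "g \<in> set (P @ Q)" "{tail G g, head G g} = {tail G e, head G e}"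
      using \<open>{tail G e, head G e} \<in> walk_edges G C\<close> unfolding Q(3)[symmetric]
      by (auto simp: walk_edges_def)
    have "f = e"
    proof (cases "tail G g = tail G e")
      case True
      then have "head G g = head G e" using g(2) by (auto simp: doubleton_eq_iff)
      moreover have "g = f"
        by (rule inj_onD[OF inj(1)]) (use True g(1) f f'(2) in simp_all)
      ultimately show ?thesis using f' e(1) no_multi_arcs by (auto simp: arc_to_ends_def)
    next
      case False
      then have g': "tail G g = v" "head G g = tail G e"
        using g(2) e(3) by (auto simp: doubleton_eq_iff)
      have "tail G e \<in> head G ` set P"
        using cas_set_heads[OF casP] \<open>u \<in> tail G ` set P\<close> dist' by auto
      then obtain h where "h \<in> set P" "head G h = tail G e" by auto
      moreover from this have "g = h"
        by (intro inj_onD[OF inj(2)]) (use g(1) g'(2) in simp_all)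
      ultimately have "g \<in> set P" by simp
      then show ?thesis using g'(1) dist' by auto
    qed
    then show ?thesis using Q f f' e(3) by (intro exI[of _ Q']) auto
  qed
qed

text \<open>The new cycle is \<open>Q\<close> followed by the reverse \<open>R\<close> of
  \<open>Q'\<close>. A repeated vertex would lie on both cycles, hence on \<open>P\<close>, which
  meets the remainders only in \<open>u\<close> and \<open>v\<close>.\<close>

lemma third_cycle:
  assumes "cycle (P @ Q)" "cycle (P @ Q')" and P: "apath u P v" "P \<noteq> []"
    and Q: "awalk v Q u" and Q': "awalk v Q' u"
    and long: "3 \<le> length (P @ Q)"
    and verts: "cycle_verts G (P @ Q) \<inter> cycle_verts G (P @ Q') = set (awalk_verts u P)"
    and edges: "walk_edges G (P @ Q) \<inter> walk_edges G (P @ Q') = walk_edges G P"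
  obtains D where "graph_cycle G D" "length D = length Q + length Q'"
proof -
  obtain R where R: "awalk u R v" "map (tail G) R = rev (map (head G) Q')"
    "map (head G) R = rev (map (tail G) Q')"
    using awalk_reverse[OF Q'] .
  have lenR: "length R = length Q'" using arg_cong[OF R(2), of length] by simp
  have awP: "awalk u P v" and casP: "cas u P v" using P by (auto simp: apath_def awalk_def)
  have distP: "distinct (map (tail G) P @ [v])"
    using P(1) unfolding apath_def awalk_verts_eq_tails[OF casP] by simp
  have u_in: "u \<in> tail G ` set P" using P(2) casP by (cases P) auto
  then have "u \<noteq> v" using distP by auto
  then have v_in: "v \<in> head G ` set P" using cas_set_heads[OF casP] by auto
  have ne: "Q \<noteq> []" "Q' \<noteq> []" using \<open>u \<noteq> v\<close> Q Q' by (auto simp: awalk_Nil_iff)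
  have closed: "awalk u (P @ Q) u" "awalk u (P @ Q') u"
    using awP Q Q' awalk_append_iff_ex by blast+
  then have cas: "cas u (P @ Q) u" "cas u (P @ Q') u" by (auto simp: awalk_def)
  have dt: "distinct (map (tail G) (P @ Q))" "distinct (map (tail G) (P @ Q'))"
    using assms(1,2) cycle_iff_distinct_tails by blast+
  then have dh: "distinct (map (head G) (P @ Q'))"
    using cas_closed_distinct_iff[OF cas(2)] by simp
  \<comment> \<open>The heads of \<open>Q'\<close> are the tails of \<open>R\<close>. A common
    vertex lies on \<open>P\<close> but is no tail of \<open>P\<close>, so it is \<open>v\<close>;
    yet \<open>v\<close> is already a head in \<open>P\<close> and cannot be one in
    \<open>Q'\<close>.\<close>
  have "tail G ` set Q \<inter> head G ` set Q' = {}"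
  proof (rule ccontr)
    assume "\<not> ?thesis"
    then obtain x where x: "x \<in> tail G ` set Q" "x \<in> head G ` set Q'" by auto
    then have "x \<in> set (awalk_verts u P)"
      using verts cycle_verts_closed(1)[OF cas(1)] cycle_verts_closed(2)[OF cas(2)] by auto
    then have "x \<in> insert v (tail G ` set P)"
      using awalk_verts_eq_tails[OF casP] by simp
    then have "x = v" using x(1) dt(1) by auto
    then show False using x(2) v_in dh by auto
  qed
  then have "distinct (map (tail G) (Q @ R))"
    using dt(1) dh R(2) by (simp add: arg_cong[OF R(2), of set, simplified])
  moreover have "awalk v (Q @ R) v" using Q R(1) awalk_append_iff_ex by blast
  ultimately have "cycle (Q @ R)" using ne unfolding cycle_iff_distinct_tails by auto
  \<comment> \<open>Otherwise \<open>Q\<close> and \<open>Q'\<close> are the same single arc from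
    \<open>v\<close> to \<open>u\<close>. Its edge is shared, so it lies on \<open>P\<close>; a path
    from \<open>u\<close> to \<open>v\<close> containing it has just one arc, and
    \<open>P @ Q\<close> would have length 2.\<close>
  moreover have "3 \<le> length (Q @ R)"
  proof (rule ccontr)
    assume "\<not> ?thesis"
    moreover have "0 < length Q" "0 < length Q'" using ne by auto
    ultimately have "length Q = 1" "length Q' = 1" using lenR unfolding length_append by linarith+
    then obtain e e' where ee: "Q = [e]" "Q' = [e']" by (auto simp: length_Suc_conv)
    then have e: "e \<in> arcs G" "tail G e = v" "head G e = u"
      and "e' \<in> arcs G" "tail G e' = v" "head G e' = u"
      using Q Q' by (auto simp: awalk_Cons_iff awalk_Nil_iff)
    then have "e = e'" using no_multi_arcs by (auto simp: arc_to_ends_def)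
    then have "{v, u} \<in> walk_edges G P"
      using edges ee e by (auto simp: walk_edges_def)
    then obtain g where g: "g \<in> set P" "{tail G g, head G g} = {v, u}"
      by (auto simp: walk_edges_def)
    then have g': "tail G g = u" "head G g = v"
      using distP by (auto simp: doubleton_eq_iff)
    obtain h P' where P': "P = h # P'" using P(2) by (cases P) auto
    then have "tail G h = u" using casP by simp
    moreover have "inj_on (tail G) (set P)" using distP by (simp add: distinct_map)
    ultimately have "h = g" using g(1) g'(1) P' by (metis inj_onD list.set_intros(1))
    \<comment> \<open>The first arc of \<open>P\<close> already reaches \<open>v\<close>, and
      \<open>v\<close> is not a tail in \<open>P\<close>, so nothing follows.\<close>
    then have "cas v P' v" using P' casP g' by simp
    then have "P' = []" using distP P' by (cases P') auto
    then show False using long ee P' by simp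
  qed
  ultimately show thesis
    using that[of "Q @ R"] lenR by (simp add: graph_cycle_def)
qed

end

section \<open>Counting lengths modulo 4\<close>

theorem theorem14:
  fixes G :: "('a, 'b) pre_digraph" and C C' :: "'b awalk" and t :: nat
  assumes "G \<in> eps12"
    and "graph_cycle G C" and "graph_cycle G C'"
    and "inter_is_path G C C' t" and "t > 0"
  shows "((of_type C 2 \<and> of_type C' 2)
          \<or> (of_type C 1 \<and> of_type C' 2) \<or> (of_type C 2 \<and> of_type C' 1) \<longrightarrow> odd t)
       \<and> (of_type C 1 \<and> of_type C' 1 \<longrightarrow> even t)"
proof -
  interpret graph G using assms(1) by (simp add: eps12_def euler_graph_def)
  obtain u P v where P: "apath u P v" "length P = t"
    and verts: "cycle_verts G C \<inter> cycle_verts G C' = set (awalk_verts u P)"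
    and edges: "walk_edges G C \<inter> walk_edges G C' = walk_edges G P"
    using assms(4) unfolding inter_is_path_def by blast
  have "P \<noteq> []" using P(2) assms(5) by auto
  have "walk_edges G P \<subseteq> walk_edges G C" "walk_edges G P \<subseteq> walk_edges G C'"
    using edges by auto
  moreover have "cycle C" "cycle C'" using assms(2,3) by (auto simp: graph_cycle_def)
  \<comment> \<open>Both cycles are rewritten to traverse \<open>P\<close> from \<open>u\<close> to
    \<open>v\<close>, with their edges and lengths unchanged.\<close>
  ultimately obtain Q Q' where
    Q: "cycle (P @ Q)" "awalk v Q u" "walk_edges G (P @ Q) = walk_edges G C"
      "length (P @ Q) = length C" and
    Q': "cycle (P @ Q')" "awalk v Q' u" "walk_edges G (P @ Q') = walk_edges G C'"
      "length (P @ Q') = length C'"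
    using cycle_extend_path[OF P(1) \<open>P \<noteq> []\<close>] by metis
  obtain D where D: "graph_cycle G D" "length D = length Q + length Q'"
  proof (rule third_cycle[OF Q(1) Q'(1) P(1) \<open>P \<noteq> []\<close> Q(2) Q'(2)])
    show "3 \<le> length (P @ Q)" using Q(4) assms(2) by (simp add: graph_cycle_def)
  qed (use verts edges Q(3) Q'(3) in \<open>auto simp: cycle_verts_def\<close>)
  \<comment> \<open>The additive form avoids truncated subtraction on naturals.\<close>
  have len: "length D + 2 * t = length C + length C'"
    using D(2) Q(4) Q'(4) P(2) by simp
  have "of_type D 1 \<or> of_type D 2" using assms(1) D(1) by (auto simp: eps12_def)
  then have "length D mod 4 = 1 \<or> length D mod 4 = 2" by (simp add: of_type_def)
  \<comment> \<open>Modulo 4 only the parity of \<open>t\<close> matters. For type sums 3 and 4 an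
    even \<open>t\<close> would give \<open>D\<close> residue 3 or 0; for type sum 2 an odd
    \<open>t\<close> would give residue 0. None of these occurs.\<close>
  moreover have "(length D mod 4 + 2 * (t mod 2)) mod 4 = (length C mod 4 + length C' mod 4) mod 4"
    using arg_cong[OF len, of "\<lambda>n. n mod 4"] mult_mod_right[of 2 t 2] by (simp add: mod_simps)
  ultimately show ?thesis
    unfolding of_type_def by (cases "even t") (auto simp: even_iff_mod_2_eq_zero odd_iff_mod_2_eq_one)
qed

end
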